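(* Let $\alpha:R\to R'$ be a Jordan homomorphism and let $R''$ be the subring of $R'$ generated by $R^\alpha$. Then: (a) the mapping $\alpha_{PE}:PE_2(R)\to PE_2(R'')$, $H\cdot E(T)\mapsto H''\cdot E(T^\alpha)$ (for finite sequences $T$ in $R$) is a well defined homomorphism of groups; (b) the mapping $\overline\alpha:C\to C''$, $R(1,0)\cdot E(T)\mapsto R'(1',0')\cdot E(T^\alpha)$ (for finite sequences $T$ in $R$) is well defined; (c) $(\alpha_{PE},\overline\alpha)$ is a homomorphism of transformation groups, i.e. $(p\cdot E(T))^{\overline\alpha}=p^{\overline\alpha}\cdot E(T^\alpha)$ for all $p\in C$ and all finite sequences $T$ in $R$.
   Context: Rings are associative with $1$. A Jordan homomorphism $\alpha:R\to R'$ satisfies $(a+b)^\alpha=a^\alpha+b^\alpha$, $1^\alpha=1'$, $(aba)^\alpha=a^\alpha b^\alpha a^\alpha$. For $t$ in a ring, $E(t):=\begin{pmatrix} t&1\\-1&0\end{pmatrix}$; for $T=(t_1,\ldots,t_n)$, $E(T):=E(t_1)\cdots E(t_n)$ ($=I$ if $n=0$), $T^\alpha:=(t_1^\alpha,\ldots,t_n^\alpha)$. $E_2(R)\leq GL_2(R)$ is generated by all $E(t)$; $H$ is its centre, $PE_2(R):=E_2(R)/H$, and similarly $H''$, $PE_2(R'')$ for $R''$. The projective line $\mathbb{P}(R)$ is the set of submodules $R(a,b)\leq R^2$ with $(a,b)$ the first row of an invertible matrix, with right action $R(a,b)\cdot M=R((a,b)M)$ of $GL_2(R)$. Points $R(a,b),R(c,d)$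 are distant if $\{(a,b),(c,d)\}$ is a basis of $R^2$. $C$ is the connected component of $R(1,0)$ in the distant graph of $\mathbb{P}(R)$ (equal to the $E_2(R)$-orbit of $R(1,0)$). $\mathbb{P}(R'')$ is identified with a subset of $\mathbb{P}(R')$ via $R''(a,b)\mapsto R'(a,b)$, and $C''$ is the connected component of $R''(1',0')$ in $\mathbb{P}(R'')$ (the $E_2(R'')$-orbit of this point). $PE_2(R)$ and $PE_2(R'')$ act on $C$ and $C''$ respectively. *)

theory Defs
  imports "HOL-Algebra.Coset"
begin

definition jordan_hom :: "('a::ring_1 \<Rightarrow> 'b::ring_1) \<Rightarrow> bool" where
  "jordan_hom \<alpha> \<longleftrightarrow>
     (\<forall>a b. \<alpha> (a + b) = \<alpha> a + \<alpha> b) \<and> \<alpha> 1 = 1 \<and>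
     (\<forall>a b. \<alpha> (a * b * a) = \<alpha> a * \<alpha> b * \<alpha> a)"

inductive_set gen_subring :: "'b::ring_1 set \<Rightarrow> 'b set" for A where
  gen_base: "x \<in> A \<Longrightarrow> x \<in> gen_subring A"
| gen_one: "1 \<in> gen_subring A"
| gen_diff: "x \<in> gen_subring A \<Longrightarrow> y \<in> gen_subring A \<Longrightarrow> x - y \<in> gen_subring A"
| gen_mult: "x \<in> gen_subring A \<Longrightarrow> y \<in> gen_subring A \<Longrightarrow> x * y \<in> gen_subring A"

datatype 'a mat2 = M2 'a 'a 'a 'a  \<comment> \<open>M2 a b c d = [[a,b],[c,d]]\<close>

fun mmult :: "'a::ring_1 mat2 \<Rightarrow> 'a mat2 \<Rightarrow> 'a mat2" where
  "mmult (M2 a b c d) (M2 a' b' c' d') =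
     M2 (a*a' + b*c') (a*b' + b*d') (c*a' + d*c') (c*b' + d*d')"

definition mid :: "'a::ring_1 mat2" where
  "mid = M2 1 0 0 1"

definition Emat :: "'a::ring_1 \<Rightarrow> 'a mat2" where
  "Emat t = M2 t 1 (-1) 0"

definition Eseq :: "'a::ring_1 list \<Rightarrow> 'a mat2" where
  "Eseq T = foldr (\<lambda>t M. mmult (Emat t) M) T mid"

text \<open>E_2(S) for a subring S: the group generated by all E(t), t in S.
  (Since E(t)^{-1} = E(0)E(-t)E(0), this is the set of all products E(T).)\<close>
definition E2 :: "'a::ring_1 set \<Rightarrow> 'a mat2 set" where
  "E2 S = {Eseq T | T. set T \<subseteq> S}"

definition E2grp :: "'a::ring_1 set \<Rightarrow> 'a mat2 monoid" where
  "E2grp S = \<lparr>carrier = E2 S, mult = mmult, one = mid\<rparr>"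

definition centreE :: "'a::ring_1 set \<Rightarrow> 'a mat2 set" where
  "centreE S = {M \<in> E2 S. \<forall>N \<in> E2 S. mmult M N = mmult N M}"

definition PE2 :: "'a::ring_1 set \<Rightarrow> 'a mat2 set monoid" where
  "PE2 S = E2grp S Mod centreE S"

definition pt :: "'a::ring_1 \<times> 'a \<Rightarrow> ('a \<times> 'a) set" where
  "pt v = {(r * fst v, r * snd v) | r. True}"

fun vmult :: "'a::ring_1 \<times> 'a \<Rightarrow> 'a mat2 \<Rightarrow> 'a \<times> 'a" where
  "vmult (x, y) (M2 a b c d) = (x*a + y*c, x*b + y*d)"

definition act :: "('a::ring_1 \<times> 'a) set \<Rightarrow> 'a mat2 \<Rightarrow> ('a \<times> 'a) set" where
  "act p M = (\<lambda>v. vmult v M) ` p"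

text \<open>C (resp. C''): the E_2-orbit of R(1,0) (resp. R'(1',0') for a subring S of R').
  Points of P(R'') are identified with points of P(R'), so the submodules are
  taken over the whole ring type.\<close>
definition Corb :: "'a::ring_1 set \<Rightarrow> ('a \<times> 'a) set set" where
  "Corb S = {act (pt (1, 0)) (Eseq T) | T. set T \<subseteq> S}"

end

theory Submission
  imports Defs
begin

text \<open>
  Let \<open>E(T)\<close> have first row \<open>(a, b)\<close> and let \<open>E(T)\<^sup>-\<^sup>1\<close> have second column \<open>(q, s)\<close>. Although
  \<open>a\<close> and \<open>b\<close> are not Jordan polynomials in the entries of \<open>T\<close>, the expressions \<open>a x s\<close>,
  \<open>b x q\<close> and \<open>a q\<close> are, so a Jordan homomorphism carries them to the corresponding
  expressions for \<open>T\<^sup>\<alpha>\<close>. If \<open>E(T)\<close> fixes \<open>R(1,0)\<close>, then \<open>b = q = 0\<close> and \<open>a\<close>, \<open>s\<close> are units, hence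
  \<open>a' q' = 0\<close> and \<open>a' w s' = 1\<close> for some \<open>w\<close>; this forces \<open>E(T\<^sup>\<alpha>)\<close> to fix \<open>R'(1',0')\<close>.
  A central \<open>E(T)\<close> is a scalar matrix. Applying the fixed-point statement to \<open>T\<close>, to a conjugate
  of \<open>T\<close> and to commutators of \<open>E(T)\<close> with transvections shows that \<open>E(T\<^sup>\<alpha>)\<close> is a scalar matrix
  commuting with \<open>R\<^sup>\<alpha>\<close>.
\<close>

section \<open>Words in elementary matrices\<close>

lemma mmult_assoc: "mmult (mmult A B) C = mmult A (mmult B C)"
  by (cases A; cases B; cases C) (simp add: algebra_simps)

lemma mmult_mid_left [simp]: "mmult mid A = A"
  by (cases A) (simp add: mid_def)

lemma mmult_mid_right [simp]: "mmult A mid = A"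
  by (cases A) (simp add: mid_def)

lemma Eseq_Nil [simp]: "Eseq [] = mid"
  by (simp add: Eseq_def)

lemma Eseq_Cons: "Eseq (t # T) = mmult (Emat t) (Eseq T)"
  by (simp add: Eseq_def)

lemma Eseq_append: "Eseq (S @ T) = mmult (Eseq S) (Eseq T)"
  by (induction S) (simp_all add: Eseq_Cons mmult_assoc)

text \<open>Built from E(t)^{-1} = E(0)E(-t)E(0), so that an inverse is again given by a word, to
  which a map can be applied letterwise.\<close>

definition inverse_word :: "'a::ring_1 list \<Rightarrow> 'a list" where
  "inverse_word T = concat (map (\<lambda>t. [0, - t, 0]) (rev T))"

lemma inverse_word_Nil [simp]: "inverse_word [] = []"
  by (simp add: inverse_word_def)

lemma inverse_word_snoc: "inverse_word (T @ [t]) = [0, - t, 0] @ inverse_word T"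
  by (simp add: inverse_word_def)

lemma Eseq_inverse_letter: "Eseq [0, - t, 0] = M2 0 (-1) 1 t"
  by (simp add: Eseq_Cons Emat_def mid_def)

lemma Eseq_single: "Eseq [t] = M2 t 1 (-1) 0"
  by (simp add: Eseq_Cons Emat_def)

lemma Eseq_inverse_right: "mmult (Eseq T) (Eseq (inverse_word T)) = mid"
proof (induction T rule: rev_induct)
  case (snoc t T)
  have "mmult (Eseq [t]) (mmult (Eseq [0, - t, 0]) N) = N" for N :: "'a mat2"
    unfolding Eseq_inverse_letter Eseq_single by (cases N) simp
  then show ?case
    using snoc by (simp only: inverse_word_snoc Eseq_append mmult_assoc)
qed simp

lemma Eseq_inverse_left: "mmult (Eseq (inverse_word T)) (Eseq T) = mid"
proof (induction T rule: rev_induct)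
  case (snoc t T)
  have *: "mmult (Eseq (inverse_word T)) (mmult (Eseq T) N) = N" for N
    using snoc by (simp flip: mmult_assoc)
  have "mmult (Eseq [0, - t, 0]) (Eseq [t]) = mid"
    unfolding Eseq_inverse_letter Eseq_single by (simp add: mid_def)
  then show ?case
    by (simp only: inverse_word_snoc Eseq_append mmult_assoc *)
qed simp

text \<open>Since E(0)^2 = -I, the three zeros multiply to E(0)^{-1}.\<close>

lemma Eseq_transvection: "Eseq [x, 0, 0, 0] = M2 1 (- x) 0 1"
  by (simp add: Eseq_Cons Emat_def mid_def)

section \<open>Action on points and the stabiliser of R(1,0)\<close>

lemma act_mmult: "act (act p M) N = act p (mmult M N)"
proof -
  have "vmult (vmult v M) N = vmult v (mmult M N)" for v
    by (cases v; cases M; cases N) (simp add: algebra_simps)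
  then show ?thesis
    by (simp add: act_def image_image)
qed

lemma act_mid [simp]: "act p mid = p"
proof -
  have "vmult v mid = v" for v :: "'a \<times> 'a"
    by (cases v) (simp add: mid_def)
  then show ?thesis by (simp add: act_def)
qed

text \<open>Both sides are cyclic left modules: second entries force b = 0, first entries give Ra =
  R. This yields only a left inverse of a.\<close>

lemma act_base_eq_base_iff:
  "act (pt (1, 0)) (M2 a b c d) = pt (1, 0) \<longleftrightarrow> b = 0 \<and> (\<exists>y. y * a = 1)"
proof -
  have L: "act (pt (1, 0)) (M2 a b c d) = range (\<lambda>r. (r * a, r * b))"
    by (auto simp: act_def pt_def image_def)
  have R: "pt (1, 0) = range (\<lambda>r :: 'a. (r, 0 :: 'a))"
    by (auto simp: pt_def)
  show ?thesis
  proof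
    assume eq: "act (pt (1, 0)) (M2 a b c d) = pt (1, 0)"
    have "(1 * a, 1 * b) \<in> range (\<lambda>r. (r * a, r * b))"
      by (rule rangeI)
    then have "(1 * a, 1 * b) \<in> range (\<lambda>r :: 'a. (r, 0 :: 'a))"
      by (simp only: eq[unfolded L, unfolded R])
    then have "b = 0" by auto
    have "(1, 0) \<in> range (\<lambda>r. (r * a, r * b))"
      unfolding eq[unfolded L, unfolded R] by (rule rangeI)
    then obtain y where "(1, 0) = (y * a, y * b)" by (rule rangeE)
    then have "y * a = 1" by simp
    with \<open>b = 0\<close> show "b = 0 \<and> (\<exists>y. y * a = 1)" by blast
  next
    assume "b = 0 \<and> (\<exists>y. y * a = 1)"
    then obtain y where b: "b = 0" and y: "y * a = 1" by blast
    have "(r, 0) \<in> range (\<lambda>r. (r * a, r * b))" for r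
      using y b by (intro range_eqI[of _ _ "r * y"]) (simp add: mult.assoc)
    then show "act (pt (1, 0)) (M2 a b c d) = pt (1, 0)"
      unfolding L unfolding R using b by auto
  qed
qed

section \<open>Groups of elementary matrices\<close>

text \<open>The closure that keeps inverse words inside S: their letters are 0 and negatives of
  letters.\<close>

definition uminus_closed :: "'a::ring_1 set \<Rightarrow> bool" where
  "uminus_closed S \<longleftrightarrow> 0 \<in> S \<and> (\<forall>x \<in> S. - x \<in> S)"

lemma uminus_closed_UNIV: "uminus_closed UNIV"
  by (simp add: uminus_closed_def)

lemma uminus_closed_gen_subring: "uminus_closed (gen_subring A)"
proof -
  have "1 - 1 \<in> gen_subring A"
    by (intro gen_diff gen_one)
  then have zero: "0 \<in> gen_subring A" by simp
  then have "0 - x \<in> gen_subring A" if "x \<in> gen_subring A" for x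
    using that by (rule gen_diff)
  with zero show ?thesis
    by (simp add: uminus_closed_def)
qed

lemma Eseq_in_E2: "set T \<subseteq> S \<Longrightarrow> Eseq T \<in> E2 S"
  by (auto simp: E2_def)

lemma set_inverse_word: "uminus_closed S \<Longrightarrow> set T \<subseteq> S \<Longrightarrow> set (inverse_word T) \<subseteq> S"
  by (auto simp: inverse_word_def uminus_closed_def)

lemma group_E2grp:
  assumes "uminus_closed S"
  shows "group (E2grp S)"
proof (rule groupI)
  fix x y assume "x \<in> carrier (E2grp S)" "y \<in> carrier (E2grp S)"
  then obtain T U where "x = Eseq T" "set T \<subseteq> S" "y = Eseq U" "set U \<subseteq> S"
    by (auto simp: E2grp_def E2_def)
  then show "x \<otimes>\<^bsub>E2grp S\<^esub> y \<in> carrier (E2grp S)"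
    using Eseq_in_E2[of "T @ U" S] by (simp add: E2grp_def Eseq_append)
next
  show "\<one>\<^bsub>E2grp S\<^esub> \<in> carrier (E2grp S)"
    using Eseq_in_E2[of "[]" S] by (simp add: E2grp_def)
next
  fix x assume "x \<in> carrier (E2grp S)"
  then obtain T where T: "x = Eseq T" "set T \<subseteq> S"
    by (auto simp: E2grp_def E2_def)
  then have "Eseq (inverse_word T) \<in> E2 S"
    using assms by (intro Eseq_in_E2 set_inverse_word)
  with T show "\<exists>y\<in>carrier (E2grp S). y \<otimes>\<^bsub>E2grp S\<^esub> x = \<one>\<^bsub>E2grp S\<^esub>"
    using Eseq_inverse_left[of T] by (auto simp: E2grp_def)
qed (simp_all add: E2grp_def mmult_assoc)

lemma normal_centreE:
  assumes "uminus_closed S"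
  shows "centreE S \<lhd> E2grp S"
proof -
  interpret group "E2grp S" by (rule group_E2grp[OF assms])
  have centre: "centreE S = {x \<in> carrier (E2grp S).
      \<forall>y \<in> carrier (E2grp S). x \<otimes>\<^bsub>E2grp S\<^esub> y = y \<otimes>\<^bsub>E2grp S\<^esub> x}"
    by (simp add: centreE_def E2grp_def)
  have "subgroup (centreE S) (E2grp S)"
  proof (rule subgroupI)
    show "centreE S \<subseteq> carrier (E2grp S)" by (auto simp: centre)
    have "\<one>\<^bsub>E2grp S\<^esub> \<in> centreE S" by (simp add: centre)
    then show "centreE S \<noteq> {}" by blast
  next
    fix x assume x: "x \<in> centreE S"
    \<comment> \<open>Invert the relation saying that x commutes with the inverse of y.\<close>
    have "inv\<^bsub>E2grp S\<^esub> x \<otimes>\<^bsub>E2grp S\<^esub> y = y \<otimes>\<^bsub>E2grp S\<^esub> inv\<^bsub>E2grp S\<^esub> x"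
      if "y \<in> carrier (E2grp S)" for y
      using x that by (simp add: centre) (metis inv_closed inv_mult_group inv_inv)
    then show "inv\<^bsub>E2grp S\<^esub> x \<in> centreE S" using x by (simp add: centre)
  next
    fix x y assume xy: "x \<in> centreE S" "y \<in> centreE S"
    have "x \<otimes>\<^bsub>E2grp S\<^esub> y \<otimes>\<^bsub>E2grp S\<^esub> z = z \<otimes>\<^bsub>E2grp S\<^esub> (x \<otimes>\<^bsub>E2grp S\<^esub> y)"
      if z: "z \<in> carrier (E2grp S)" for z
    proof -
      have carr: "x \<in> carrier (E2grp S)" "y \<in> carrier (E2grp S)"
        and comm: "y \<otimes>\<^bsub>E2grp S\<^esub> z = z \<otimes>\<^bsub>E2grp S\<^esub> y" "x \<otimes>\<^bsub>E2grp S\<^esub> z = z \<otimes>\<^bsub>E2grp S\<^esub> x"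
        using xy z unfolding centre by blast+
      have "x \<otimes>\<^bsub>E2grp S\<^esub> y \<otimes>\<^bsub>E2grp S\<^esub> z = x \<otimes>\<^bsub>E2grp S\<^esub> z \<otimes>\<^bsub>E2grp S\<^esub> y"
        by (simp only: m_assoc carr z comm(1))
      then show ?thesis by (simp only: comm(2) m_assoc carr z)
    qed
    then show "x \<otimes>\<^bsub>E2grp S\<^esub> y \<in> centreE S"
      using xy unfolding centre by blast
  qed
  moreover have "x \<otimes>\<^bsub>E2grp S\<^esub> h \<otimes>\<^bsub>E2grp S\<^esub> inv\<^bsub>E2grp S\<^esub> x \<in> centreE S"
    if x: "x \<in> carrier (E2grp S)" and h: "h \<in> centreE S" for x h
  proof -
    have carr: "h \<in> carrier (E2grp S)" and "x \<otimes>\<^bsub>E2grp S\<^esub> h = h \<otimes>\<^bsub>E2grp S\<^esub> x"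
      using x h unfolding centre by auto
    then have "x \<otimes>\<^bsub>E2grp S\<^esub> h \<otimes>\<^bsub>E2grp S\<^esub> inv\<^bsub>E2grp S\<^esub> x = h"
      using x by (simp only: m_assoc inv_closed r_inv r_one)
    with h show ?thesis by simp
  qed
  ultimately show ?thesis
    unfolding normal_inv_iff by blast
qed

section \<open>Scalar matrices and the centre\<close>

lemma centreE_UNIV_scalar:
  assumes "M \<in> centreE (UNIV :: 'a::ring_1 set)"
  obtains a where "M = M2 a 0 0 a" "\<And>x. a * x = x * a"
proof -
  obtain a b c d where M: "M = M2 a b c d" by (cases M)
  have comm: "mmult M (Eseq [t]) = mmult (Eseq [t]) M" for t
    using assms Eseq_in_E2[of "[t]" UNIV] by (auto simp: centreE_def)
  \<comment> \<open>First rows of M E(t) = E(t) M. The cases t = 0 and t = 1 make M scalar; then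
    arbitrary t makes a central in the ring.\<close>
  have entries: "a * t - b = t * a + c" "a = t * b + d" for t
    using comm[of t] unfolding M Eseq_single mmult.simps mat2.inject by auto
  have d: "d = a" and c: "c = - b" using entries[of 0] by simp_all
  have b: "b = 0" using entries(2)[of 1] by (simp add: d)
  have "a * x = x * a" for x using entries(1)[of x] by (simp add: b c)
  then show thesis using that[of a] M by (simp add: b c d)
qed

text \<open>The centraliser of a is a subring. This extends commutation with the image of a Jordan
  homomorphism to all of R''.\<close>

lemma centralizer_gen_subring:
  assumes "\<And>x. x \<in> A \<Longrightarrow> a * x = x * (a :: 'a::ring_1)" "x \<in> gen_subring A"
  shows "a * x = x * a"
  using assms(2)
proof (induction rule: gen_subring.induct)
  case (gen_mult x y)
  then show ?case by (metis mult.assoc)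
qed (simp_all add: assms(1) algebra_simps)

lemma scalar_in_centreE:
  assumes "M2 a 0 0 a \<in> E2 S" "\<And>x. x \<in> S \<Longrightarrow> a * x = x * a"
  shows "M2 a 0 0 a \<in> centreE S"
proof -
  have "mmult (M2 a 0 0 a) (Eseq T) = mmult (Eseq T) (M2 a 0 0 a)" if "set T \<subseteq> S" for T
    using that
  proof (induction T)
    case (Cons t T)
    then have "a * t = t * a" using assms(2) by simp
    then have "mmult (M2 a 0 0 a) (Emat t) = mmult (Emat t) (M2 a 0 0 a)"
      by (simp add: Emat_def)
    with Cons show ?case by (simp add: Eseq_Cons) (metis mmult_assoc)
  qed (simp add: mid_def)
  with assms(1) show ?thesis by (auto simp: centreE_def E2_def)
qed

section \<open>Cosets represented by words\<close>

lemma set_map_gen_subring: "set (map f T) \<subseteq> gen_subring (range f)"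
  by (auto intro: gen_base)

lemma carrier_PE2: "carrier (PE2 S) = {centreE S #>\<^bsub>E2grp S\<^esub> Eseq T | T. set T \<subseteq> S}"
  by (auto simp: PE2_def FactGroup_def RCOSETS_def E2grp_def E2_def)

text \<open>Turns multiplication of cosets into concatenation of words, which letterwise maps
  respect.\<close>

lemma mult_PE2:
  assumes "uminus_closed S" "set T \<subseteq> S" "set U \<subseteq> S"
  shows "(centreE S #>\<^bsub>E2grp S\<^esub> Eseq T) \<otimes>\<^bsub>PE2 S\<^esub> (centreE S #>\<^bsub>E2grp S\<^esub> Eseq U)
       = centreE S #>\<^bsub>E2grp S\<^esub> Eseq (T @ U)"
proof -
  interpret normal "centreE S" "E2grp S" by (rule normal_centreE[OF assms(1)])
  have "Eseq T \<in> carrier (E2grp S)" "Eseq U \<in> carrier (E2grp S)"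
    using assms Eseq_in_E2 by (auto simp: E2grp_def)
  from rcos_sum[OF this] show ?thesis
    by (simp add: PE2_def FactGroup_def Eseq_append) (simp add: E2grp_def)
qed

section \<open>Jordan homomorphisms\<close>

context
  fixes \<alpha> :: "'a::ring_1 \<Rightarrow> 'b::ring_1"
  assumes jordan: "jordan_hom \<alpha>"
begin

lemma jordan_add: "\<alpha> (x + y) = \<alpha> x + \<alpha> y"
  using jordan by (simp add: jordan_hom_def)

lemma jordan_one: "\<alpha> 1 = 1"
  using jordan by (simp add: jordan_hom_def)

lemma jordan_zero: "\<alpha> 0 = 0"
  using jordan_add[of 0 0] by simp

lemma jordan_uminus: "\<alpha> (- x) = - \<alpha> x"
  using jordan_add[of x "- x"] by (simp add: jordan_zero eq_neg_iff_add_eq_0 add.commute)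

lemma jordan_diff: "\<alpha> (x - y) = \<alpha> x - \<alpha> y"
  using jordan_add[of x "- y"] by (simp add: jordan_uminus)

lemma jordan_sandwich: "\<alpha> (x * y * x) = \<alpha> x * \<alpha> y * \<alpha> x"
  using jordan by (simp add: jordan_hom_def)

text \<open>Linearisation of \<open>jordan_sandwich\<close> in the outer variable, replacing x by x
  + z.\<close>

lemma jordan_triple: "\<alpha> (x * y * z + z * y * x) = \<alpha> x * \<alpha> y * \<alpha> z + \<alpha> z * \<alpha> y * \<alpha> x"
proof -
  have "x * y * z + z * y * x = (x + z) * y * (x + z) - x * y * x - z * y * z"
    by (simp add: algebra_simps)
  then have "\<alpha> (x * y * z + z * y * x) = \<alpha> ((x + z) * y * (x + z) - x * y * x - z * y * z)"
    by simp
  also have "\<dots> = \<alpha> x * \<alpha> y * \<alpha> z + \<alpha> z * \<alpha> y * \<alpha> x"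
    unfolding jordan_diff jordan_sandwich jordan_add by (simp add: algebra_simps)
  finally show ?thesis .
qed

text \<open>Inverse words are formed with 0 and negation alone, so additivity of \<alpha> is enough
  to transport them.\<close>

lemma map_inverse_word: "map \<alpha> (inverse_word T) = inverse_word (map \<alpha> T)"
  by (induction T rule: rev_induct)
     (simp_all add: inverse_word_snoc jordan_zero jordan_uminus)

text \<open>The second conjunct is the linearisation of the others that closes the induction.\<close>

lemma jordan_row_column:
  assumes "Eseq T = M2 a b c d" "Eseq (inverse_word T) = M2 p q r s"
    and "Eseq (map \<alpha> T) = M2 a' b' c' d'" "Eseq (inverse_word (map \<alpha> T)) = M2 p' q' r' s'"
  shows "(\<forall>x. \<alpha> (a * x * s) = a' * \<alpha> x * s') \<and>
    (\<forall>x y. \<alpha> (a * y * x * q - b * x * y * s) = a' * \<alpha> y * \<alpha> x * q' - b' * \<alpha> x * \<alpha> y * s') \<and>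
    (\<forall>x. \<alpha> (b * x * q) = b' * \<alpha> x * q') \<and> \<alpha> (a * q) = a' * q'"
  using assms
proof (induction T arbitrary: a b c d p q r s a' b' c' d' p' q' r' s' rule: rev_induct)
  case Nil
  then show ?case by (simp add: mid_def jordan_zero)
next
  case (snoc t T)
  obtain a0 b0 c0 d0 where M: "Eseq T = M2 a0 b0 c0 d0" by (cases "Eseq T")
  obtain p0 q0 r0 s0 where N: "Eseq (inverse_word T) = M2 p0 q0 r0 s0"
    by (cases "Eseq (inverse_word T)")
  obtain a1 b1 c1 d1 where M': "Eseq (map \<alpha> T) = M2 a1 b1 c1 d1" by (cases "Eseq (map \<alpha> T)")
  obtain p1 q1 r1 s1 where N': "Eseq (inverse_word (map \<alpha> T)) = M2 p1 q1 r1 s1"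
    by (cases "Eseq (inverse_word (map \<alpha> T))")
  note IH = snoc.IH[OF M N M' N']
  have A: "\<alpha> (a0 * x * s0) = a1 * \<alpha> x * s1" for x using IH by blast
  have B: "\<alpha> (a0 * y * x * q0 - b0 * x * y * s0) = a1 * \<alpha> y * \<alpha> x * q1 - b1 * \<alpha> x * \<alpha> y * s1"
    for x y using IH by blast
  have C: "\<alpha> (b0 * x * q0) = b1 * \<alpha> x * q1" for x using IH by blast
  have D: "\<alpha> (a0 * q0) = a1 * q1" using IH by blast
  \<comment> \<open>Upper right entry of E(T) E(T)^{-1} = I. It trades b s for a q in the last
    conjunct.\<close>
  have "a0 * q0 + b0 * s0 = 0"
    using Eseq_inverse_right[of T] by (simp add: M N mid_def)
  then have bs: "b0 * s0 = - (a0 * q0)"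
    by (metis add.commute eq_neg_iff_add_eq_0)
  have "a1 * q1 + b1 * s1 = 0"
    using Eseq_inverse_right[of "map \<alpha> T"] by (simp add: M' N' mid_def)
  then have bs': "b1 * s1 = - (a1 * q1)"
    by (metis add.commute eq_neg_iff_add_eq_0)
  \<comment> \<open>Appending t multiplies E(T) by E(t) on the right and the inverse by E(t)^{-1} on
    the left, so the first row and the second column obey recursions of their own.\<close>
  have new: "a = a0 * t - b0" "b = a0" "q = - s0" "s = q0 + t * s0"
    "a' = a1 * \<alpha> t - b1" "b' = a1" "q' = - s1" "s' = q1 + \<alpha> t * s1"
    using snoc.prems M N M' N'
    unfolding inverse_word_snoc Eseq_append map_append list.map Eseq_single Eseq_inverse_letter
    by auto
  have "\<alpha> (a * x * s) = a' * \<alpha> x * s'" for x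
  proof -
    \<comment> \<open>A sandwich t x t, then the two mixed terms as one instance of \<open>B\<close>
      with y = t, then \<open>C\<close>.\<close>
    have "a * x * s = a0 * (t * x * t) * s0 + (a0 * t * x * q0 - b0 * x * t * s0) - b0 * x * q0"
      unfolding new by (simp add: algebra_simps)
    then have "\<alpha> (a * x * s) = a1 * (\<alpha> t * \<alpha> x * \<alpha> t) * s1
        + (a1 * \<alpha> t * \<alpha> x * q1 - b1 * \<alpha> x * \<alpha> t * s1) - b1 * \<alpha> x * q1"
      by (simp only: jordan_add jordan_diff[of _ "b0 * x * q0"] A B C jordan_sandwich)
    then show ?thesis unfolding new by (simp add: algebra_simps)
  qed
  moreover have "\<alpha> (a * y * x * q - b * x * y * s) = a' * \<alpha> y * \<alpha> x * q' - b' * \<alpha> x * \<alpha> y * s'"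
    for x y
  proof -
    \<comment> \<open>The terms in s0 containing t form a Jordan triple; the rest is
      \<open>B\<close> with x and y exchanged.\<close>
    have "a * y * x * q - b * x * y * s
        = - (a0 * (t * y * x + x * y * t) * s0) - (a0 * x * y * q0 - b0 * y * x * s0)"
      unfolding new by (simp add: algebra_simps)
    then have "\<alpha> (a * y * x * q - b * x * y * s)
        = - (a1 * (\<alpha> t * \<alpha> y * \<alpha> x + \<alpha> x * \<alpha> y * \<alpha> t) * s1)
          - (a1 * \<alpha> x * \<alpha> y * q1 - b1 * \<alpha> y * \<alpha> x * s1)"
      by (simp only: jordan_uminus jordan_diff[of "- _"] A B jordan_triple)
    then show ?thesis unfolding new by (simp add: algebra_simps)
  qed
  \<comment> \<open>Here b x q = - a0 x s0, the first conjunct for the shorter word.\<close>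
  moreover have "\<alpha> (b * x * q) = b' * \<alpha> x * q'" for x
    using A[of x] by (simp add: new jordan_uminus)
  moreover have "\<alpha> (a * q) = a' * q'"
  proof -
    have "a * q = - (a0 * t * s0) - a0 * q0"
      unfolding new using bs by (simp add: algebra_simps)
    then have "\<alpha> (a * q) = - (a1 * \<alpha> t * s1) - a1 * q1"
      by (simp only: jordan_diff jordan_uminus A D)
    also have "\<dots> = a' * q'"
      unfolding new using bs' by (simp add: algebra_simps)
    finally show ?thesis .
  qed
  ultimately show ?case by blast
qed

text \<open>Rings need not be Dedekind finite, so one-sided inverses have to be upgraded: the
  transported identity makes a' right invertible and s' left invertible, whereas the conclusion asks
  for a left inverse of a'.\<close>

lemma jordan_fixes_base:
  assumes "act (pt (1, 0)) (Eseq T) = pt (1, 0)"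
  shows "act (pt (1, 0)) (Eseq (map \<alpha> T)) = pt (1, 0)"
proof -
  obtain a b c d where M: "Eseq T = M2 a b c d" by (cases "Eseq T")
  obtain p q r s where N: "Eseq (inverse_word T) = M2 p q r s"
    by (cases "Eseq (inverse_word T)")
  obtain a' b' c' d' where M': "Eseq (map \<alpha> T) = M2 a' b' c' d'" by (cases "Eseq (map \<alpha> T)")
  obtain p' q' r' s' where N': "Eseq (inverse_word (map \<alpha> T)) = M2 p' q' r' s'"
    by (cases "Eseq (inverse_word (map \<alpha> T))")
  from assms obtain y where b: "b = 0" and y: "y * a = 1"
    unfolding M act_base_eq_base_iff by blast
  have MN: "a * p = 1" "a * q = 0" "c * q + d * s = 1"
    using Eseq_inverse_right[of T] by (simp_all add: M N mid_def b)
  have MN': "a' * p' + b' * r' = 1" "a' * q' + b' * s' = 0" "c' * q' + d' * s' = 1"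
    using Eseq_inverse_right[of "map \<alpha> T"] by (simp_all add: M' N' mid_def)
  have NM': "p' * a' + q' * c' = 1" "p' * b' + q' * d' = 0" "r' * a' + s' * c' = 0"
      "r' * b' + s' * d' = 1"
    using Eseq_inverse_left[of "map \<alpha> T"] by (simp_all add: M' N' mid_def)
  have "q = 0"
    using MN(2) y by (metis mult.assoc mult_1 mult_zero_right)
  then have "d * s = 1" using MN(3) by simp
  \<comment> \<open>The middle factor p d is chosen so that a x s becomes (a p)(d s) = 1, an
    identity that \<alpha> transports.\<close>
  with MN(1) have "a * (p * d) * s = 1" by (metis mult.assoc mult_1)
  then have w: "a' * \<alpha> (p * d) * s' = 1"
    using jordan_row_column[OF M N M' N'] by (metis jordan_one)
  have aq': "a' * q' = 0"
    using jordan_row_column[OF M N M' N'] MN(2) by (metis jordan_zero)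
  then have bs': "b' * s' = 0" using MN'(2) by simp
  \<comment> \<open>\<open>a'\<close> is right invertible, so \<open>a' p' a' = a'\<close> upgrades to \<open>a' p' = 1\<close>; dually for \<open>s'\<close>.\<close>
  have "a' * (p' * a') = a' * (1 - q' * c')"
    using NM'(1) by (metis add_diff_cancel_right')
  also have "\<dots> = a'" using aq' by (simp add: algebra_simps flip: mult.assoc)
  finally have "a' * p' = 1"
    using w by (metis mult.assoc mult_1_right)
  then have br': "b' * r' = 0" using MN'(1) by simp
  \<comment> \<open>Multiply the lower right entry of E^{-1} E = I by b' from the left; both
    summands vanish.\<close>
  have "b' = b' * (r' * b' + s' * d')" using NM'(4) by simp
  also have "\<dots> = 0" using br' bs' by (simp add: algebra_simps flip: mult.assoc)
  finally have b': "b' = 0" .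
  then have qd': "q' * d' = 0" and sd': "s' * d' = 1" using NM' by simp_all
  \<comment> \<open>Now s' has a left inverse, from \<open>w\<close>, and the right inverse d';
    hence they agree and d' is two-sided.\<close>
  have "d' * s' = a' * \<alpha> (p * d) * (s' * d') * s'"
    using w by (simp only: mult.assoc[symmetric] mult_1)
  then have "d' * s' = 1" using w sd' by simp
  then have "q' = 0"
    using qd' by (metis mult.assoc mult_1_right mult_zero_left)
  then have "p' * a' = 1" using NM'(1) by simp
  with b' show ?thesis
    unfolding M' act_base_eq_base_iff by blast
qed

lemma jordan_upper_right_zero:
  assumes "Eseq T = M2 a 0 c d" "y * a = 1" "Eseq (map \<alpha> T) = M2 a' b' c' d'"
  shows "b' = 0"
  using jordan_fixes_base[of T] assms by (auto simp: act_base_eq_base_iff)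

section \<open>Transport of the centre, of cosets and of points\<close>

lemma jordan_centre:
  assumes "Eseq T \<in> centreE UNIV"
  shows "Eseq (map \<alpha> T) \<in> centreE (gen_subring (range \<alpha>))"
proof -
  obtain a where M: "Eseq T = M2 a 0 0 a" and a: "\<And>x. a * x = x * a"
    using centreE_UNIV_scalar[OF assms] by blast
  obtain p q r s where N: "Eseq (inverse_word T) = M2 p q r s"
    by (cases "Eseq (inverse_word T)")
  obtain a' b' c' d' where M': "Eseq (map \<alpha> T) = M2 a' b' c' d'" by (cases "Eseq (map \<alpha> T)")
  obtain p' q' r' s' where N': "Eseq (inverse_word (map \<alpha> T)) = M2 p' q' r' s'"
    by (cases "Eseq (inverse_word (map \<alpha> T))")
  have NM: "p * a = 1"
    using Eseq_inverse_left[of T] by (simp_all add: M N mid_def)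
  have b': "b' = 0" using jordan_upper_right_zero[OF M NM M'] .
  have c': "c' = 0"
  proof -
    \<comment> \<open>Conjugation by E(0) fixes scalar matrices and moves the lower left entry, up
      to sign, to the upper right.\<close>
    have "Eseq ([0] @ T @ [0, 0, 0]) = M2 a 0 0 a"
      by (simp only: Eseq_append M) (simp add: Eseq_Cons Emat_def)
    moreover have "Eseq (map \<alpha> ([0] @ T @ [0, 0, 0])) = M2 d' (- c') (- b') a'"
      by (simp only: Eseq_append M' map_append list.map jordan_zero) (simp add: Eseq_Cons Emat_def)
    ultimately have "- c' = 0" using jordan_upper_right_zero NM by blast
    then show ?thesis by simp
  qed
  have inv': "a' * p' = 1" "s' * d' = 1" "q' = 0" "r' = 0"
  proof -
    have *: "a' * p' = 1" "a' * q' = 0" "d' * r' = 0" "p' * a' = 1" "s' * d' = 1"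
      using Eseq_inverse_right[of "map \<alpha> T"] Eseq_inverse_left[of "map \<alpha> T"]
      by (simp_all add: M' N' b' c' mid_def)
    then show "a' * p' = 1" "s' * d' = 1" by blast+
    show "q' = 0" "r' = 0" using * by (metis mult.assoc mult_1 mult_zero_right)+
  qed
  have twist: "a' * \<alpha> x = \<alpha> x * d'" for x
  proof -
    \<comment> \<open>A commutator word of E(T) with a transvection. It represents I because the
      scalar a is central.\<close>
    let ?U = "T @ [x, 0, 0, 0] @ inverse_word T @ [- x, 0, 0, 0]"
    have "mmult (Eseq T) (Eseq [x, 0, 0, 0]) = mmult (Eseq [x, 0, 0, 0]) (Eseq T)"
      unfolding M Eseq_transvection using a by simp
    then have "Eseq ?U = mmult (Eseq [x, 0, 0, 0])
        (mmult (mmult (Eseq T) (Eseq (inverse_word T))) (Eseq [- x, 0, 0, 0]))"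
      by (simp only: Eseq_append) (metis mmult_assoc)
    also have "\<dots> = M2 1 0 0 1"
      unfolding Eseq_inverse_right Eseq_transvection by simp
    finally have U: "Eseq ?U = M2 1 0 0 1" .
    have "Eseq (map \<alpha> ?U) = M2 1 (\<alpha> x - a' * \<alpha> x * s') 0 (d' * s')"
      unfolding map_append Eseq_append map_inverse_word list.map jordan_zero jordan_uminus
        Eseq_transvection M' N'
      by (simp add: b' c' inv' right_diff_distrib flip: mult.assoc)
    \<comment> \<open>The image word is not yet known to represent I, but its upper right entry must
      vanish.\<close>
    from jordan_upper_right_zero[OF U _ this] have "\<alpha> x = a' * \<alpha> x * s'"
      by (metis mult_1 right_minus_eq)
    then show ?thesis using inv'(2) by (metis mult.assoc mult_1_right)
  qed
  from twist[of 1] have d': "d' = a'" by (simp add: jordan_one)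
  have "a' * y = y * a'" if "y \<in> range \<alpha>" for y
    using that twist unfolding d' by blast
  then have "a' * x = x * a'" if "x \<in> gen_subring (range \<alpha>)" for x
    using that by (rule centralizer_gen_subring)
  moreover have "M2 a' 0 0 a' \<in> E2 (gen_subring (range \<alpha>))"
    using Eseq_in_E2[OF set_map_gen_subring, of \<alpha> T] unfolding M' b' c' d' .
  ultimately show ?thesis
    unfolding M' b' c' d' by (intro scalar_in_centreE)
qed

text \<open>Equal cosets mean that T followed by the inverse word of U represents a central matrix;
  \<open>jordan_centre\<close> applies to this single word.\<close>

lemma jordan_coset_eq:
  assumes "centreE UNIV #>\<^bsub>E2grp UNIV\<^esub> Eseq T = centreE UNIV #>\<^bsub>E2grp UNIV\<^esub> Eseq U"
  shows "centreE (gen_subring (range \<alpha>)) #>\<^bsub>E2grp (gen_subring (range \<alpha>))\<^esub> Eseq (map \<alpha> T)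
       = centreE (gen_subring (range \<alpha>)) #>\<^bsub>E2grp (gen_subring (range \<alpha>))\<^esub> Eseq (map \<alpha> U)"
proof -
  let ?S = "gen_subring (range \<alpha>)"
  interpret G: group "E2grp (UNIV :: 'a set)" by (rule group_E2grp[OF uminus_closed_UNIV])
  interpret G': group "E2grp ?S" by (rule group_E2grp[OF uminus_closed_gen_subring])
  interpret H: normal "centreE UNIV" "E2grp (UNIV :: 'a set)"
    by (rule normal_centreE[OF uminus_closed_UNIV])
  interpret H': normal "centreE ?S" "E2grp ?S"
    by (rule normal_centreE[OF uminus_closed_gen_subring])
  have "Eseq T \<in> carrier (E2grp UNIV)"
    using Eseq_in_E2[of T UNIV] by (simp add: E2grp_def)
  then have "Eseq T \<in> centreE UNIV #>\<^bsub>E2grp UNIV\<^esub> Eseq U"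
    using assms G.rcos_self H.subgroup_axioms by metis
  then obtain h where h: "h \<in> centreE UNIV" "Eseq T = mmult h (Eseq U)"
    by (auto simp: r_coset_def E2grp_def)
  then have "Eseq (T @ inverse_word U) = h"
    by (simp add: Eseq_append mmult_assoc Eseq_inverse_right)
  with h have "Eseq (map \<alpha> (T @ inverse_word U)) \<in> centreE ?S"
    by (intro jordan_centre) simp
  moreover have "Eseq (map \<alpha> T) = mmult (Eseq (map \<alpha> (T @ inverse_word U))) (Eseq (map \<alpha> U))"
    by (simp add: map_inverse_word Eseq_append mmult_assoc Eseq_inverse_left)
  ultimately have "Eseq (map \<alpha> T) \<in> centreE ?S #>\<^bsub>E2grp ?S\<^esub> Eseq (map \<alpha> U)"
    by (auto simp: r_coset_def E2grp_def)
  moreover have "Eseq (map \<alpha> U) \<in> carrier (E2grp ?S)"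
    using Eseq_in_E2[OF set_map_gen_subring] by (simp add: E2grp_def)
  ultimately show ?thesis
    using G'.repr_independence H'.subgroup_axioms by metis
qed

text \<open>The same reduction to one word, with the stabiliser of R(1,0) in place of the
  centre.\<close>

lemma jordan_point_eq:
  assumes "act (pt (1, 0)) (Eseq T) = act (pt (1, 0)) (Eseq U)"
  shows "act (pt (1, 0)) (Eseq (map \<alpha> T)) = act (pt (1, 0)) (Eseq (map \<alpha> U))"
proof -
  have "act (act (pt (1, 0)) (Eseq T)) (Eseq (inverse_word U)) = pt (1, 0)"
    by (simp only: assms) (simp only: act_mmult Eseq_inverse_right act_mid)
  then have "act (pt (1, 0)) (Eseq (T @ inverse_word U)) = pt (1, 0)"
    by (simp only: act_mmult Eseq_append)
  then have "act (pt (1, 0)) (Eseq (map \<alpha> (T @ inverse_word U))) = pt (1, 0)"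
    by (rule jordan_fixes_base)
  then have "act (act (pt (1, 0)) (Eseq (map \<alpha> (T @ inverse_word U)))) (Eseq (map \<alpha> U))
      = act (pt (1, 0)) (Eseq (map \<alpha> U))"
    by simp
  then show ?thesis
    by (simp add: act_mmult map_inverse_word Eseq_append mmult_assoc Eseq_inverse_left)
qed

end

theorem theorem4p4:
  fixes \<alpha> :: "'a::ring_1 \<Rightarrow> 'b::ring_1"
  assumes "jordan_hom \<alpha>"
  defines "R'' \<equiv> gen_subring (range \<alpha>)"
  shows "(\<exists>f. f \<in> hom (PE2 (UNIV :: 'a set)) (PE2 R'') \<and>
              (\<forall>T. f (centreE (UNIV :: 'a set) #>\<^bsub>E2grp (UNIV :: 'a set)\<^esub> Eseq T)
                    = centreE R'' #>\<^bsub>E2grp R''\<^esub> Eseq (map \<alpha> T)))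
       \<and> (\<exists>\<phi>. \<phi> \<in> Corb (UNIV :: 'a set) \<rightarrow> Corb R'' \<and>
              (\<forall>T. \<phi> (act (pt (1, 0)) (Eseq T)) = act (pt (1, 0)) (Eseq (map \<alpha> T))) \<and>
              (\<forall>p \<in> Corb (UNIV :: 'a set). \<forall>T.
                  \<phi> (act p (Eseq T)) = act (\<phi> p) (Eseq (map \<alpha> T))))"
proof
  have words: "set (map \<alpha> T) \<subseteq> R''" for T
    unfolding R''_def by (rule set_map_gen_subring)
  let ?k = "\<lambda>T :: 'a list. centreE UNIV #>\<^bsub>E2grp UNIV\<^esub> Eseq T"
  let ?k' = "\<lambda>T. centreE R'' #>\<^bsub>E2grp R''\<^esub> Eseq T"
  \<comment> \<open>A representing word is chosen; \<open>jordan_coset_eq\<close> makes the value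
    independent of the choice.\<close>
  define f where "f X = ?k' (map \<alpha> (SOME T. X = ?k T))" for X
  have f: "f (?k T) = ?k' (map \<alpha> T)" for T
  proof -
    have "?k T = ?k (SOME U. ?k T = ?k U)" by (rule someI[of _ T]) simp
    from jordan_coset_eq[OF assms(1) this] show ?thesis by (simp add: f_def R''_def)
  qed
  have closed: "uminus_closed R''"
    unfolding R''_def by (rule uminus_closed_gen_subring)
  have "f \<in> hom (PE2 UNIV) (PE2 R'')"
  proof (rule homI)
    fix x :: "'a mat2 set" assume "x \<in> carrier (PE2 UNIV)"
    then obtain T where "x = ?k T" by (auto simp: carrier_PE2)
    then show "f x \<in> carrier (PE2 R'')"
      unfolding carrier_PE2 using words[of T] f[of T] by blast
  next
    fix x y :: "'a mat2 set" assume "x \<in> carrier (PE2 UNIV)" "y \<in> carrier (PE2 UNIV)"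
    then obtain T U where "x = ?k T" "y = ?k U" by (auto simp: carrier_PE2)
    then show "f (x \<otimes>\<^bsub>PE2 UNIV\<^esub> y) = f x \<otimes>\<^bsub>PE2 R''\<^esub> f y"
      using mult_PE2[OF uminus_closed_UNIV, of T U] mult_PE2[OF closed words words, of T U]
      by (simp add: f)
  qed
  with f show "\<exists>f. f \<in> hom (PE2 (UNIV :: 'a set)) (PE2 R'') \<and> (\<forall>T. f (?k T) = ?k' (map \<alpha> T))"
    by blast

  let ?q = "\<lambda>T :: 'a list. act (pt (1, 0)) (Eseq T)"
  let ?q' = "\<lambda>T :: 'b list. act (pt (1, 0)) (Eseq T)"
  \<comment> \<open>As for \<open>f\<close>, with independence supplied by
    \<open>jordan_point_eq\<close>.\<close>
  define \<phi> where "\<phi> X = ?q' (map \<alpha> (SOME T. X = ?q T))" for X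
  have \<phi>: "\<phi> (?q T) = ?q' (map \<alpha> T)" for T
  proof -
    have "?q T = ?q (SOME U. ?q T = ?q U)" by (rule someI[of _ T]) simp
    from jordan_point_eq[OF assms(1) this] show ?thesis by (simp add: \<phi>_def)
  qed
  have "\<phi> \<in> Corb UNIV \<rightarrow> Corb R''"
    using \<phi> words by (fastforce simp: Corb_def)
  moreover have "\<phi> (act p (Eseq T)) = act (\<phi> p) (Eseq (map \<alpha> T))" if "p \<in> Corb UNIV" for p T
  proof -
    from that obtain S where p: "p = ?q S" by (auto simp: Corb_def)
    \<comment> \<open>Acting by E(T) appends T to a word for p, so equivariance reduces to the value
      of \<open>\<phi>\<close> at S @ T.\<close>
    then have "act p (Eseq T) = ?q (S @ T)" by (simp add: act_mmult Eseq_append)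
    then have "\<phi> (act p (Eseq T)) = ?q' (map \<alpha> S @ map \<alpha> T)" using \<phi>[of "S @ T"] by simp
    also have "\<dots> = act (\<phi> p) (Eseq (map \<alpha> T))"
      by (simp add: p \<phi> act_mmult Eseq_append)
    finally show ?thesis .
  qed
  ultimately show "\<exists>\<phi>. \<phi> \<in> Corb (UNIV :: 'a set) \<rightarrow> Corb R'' \<and>
      (\<forall>T. \<phi> (?q T) = ?q' (map \<alpha> T)) \<and>
      (\<forall>p \<in> Corb (UNIV :: 'a set). \<forall>T. \<phi> (act p (Eseq T)) = act (\<phi> p) (Eseq (map \<alpha> T)))"
    using \<phi> by blast
qed

end
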